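(* Let $\{X_t\}_{t\geqslant 0}$ and $\{\tilde X_t\}_{t\geqslant 0}$ be stochastic processes in $\mathbb R^d$ with transition probabilities $(p_t)_{t\geqslant 0}$ and $(\tilde p_t)_{t\geqslant 0}$, and let $\rho(\cdot,\cdot)$ be a metric on $\mathcal P(\mathbb R^d)$. Assume that $(p_t)_{t\geqslant 0}$ has an invariant distribution $\pi\in\mathcal P(\mathbb R^d)$ and that there exist constants $C,\beta>0$ such that $$\rho(\nu p_t,\pi)\leqslant Ce^{-\beta t}\rho(\nu,\pi)\qquad\text{for all }\nu\in\mathcal P(\mathbb R^d)\text{ and }t\geqslant 0,$$ and that for any $T>0$ there exists a constant $\varepsilon(T)$ such that $$\sup_{0\leqslant t\leqslant T}\rho(\nu\tilde p_t,\nu p_t)\leqslant\varepsilon(T)\qquad\text{for all }\nu\in\mathcal P(\mathbb R^d).$$ Then there exist constants $T_0,\lambda>0$ such that for every $\nu\in\mathcal P(\mathbb R^d)$ $$\rho(\nu\tilde p_t,\pi)\leqslant 2\varepsilon(T_0)+2M_0e^{-\lambda t}\qquad\text{for all }t\geqslant 0,$$ where $M_0:=\sup_{s\in[0,T_0]}\rho(\nu\tilde p_s,\pi)$.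
   Context: $\mathcal P(\mathbb R^d)$ is the set of all probability distributions on $\mathbb R^d$. The processes are time-homogeneous Markov processes; for $\nu\in\mathcal P(\mathbb R^d)$, $\nu p_t\in\mathcal P(\mathbb R^d)$ (resp. $\nu\tilde p_t$) is the law of $X_t$ (resp. $\tilde X_t$) when $X_0\sim\nu$ (resp. $\tilde X_0\sim\nu$), so that $(\nu p_t)p_s=\nu p_{t+s}$ and $(\nu\tilde p_t)\tilde p_s=\nu\tilde p_{t+s}$. A distribution $\pi$ is invariant for $(p_t)$ if $\pi p_t=\pi$ for all $t\geqslant 0$. *)

theory Defs
  imports "HOL-Probability.Probability"
begin

abbreviation prob_measures :: "'a::topological_space measure set" where
  "prob_measures \<equiv> space (prob_algebra borel)"

definition natural_filtration ::
    "'w measure \<Rightarrow> (real \<Rightarrow> 'w \<Rightarrow> 'a::topological_space) \<Rightarrow> real \<Rightarrow> 'w measure" where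
  "natural_filtration M X s =
     sigma (space M) {X u -` A \<inter> space M |u A. 0 \<le> u \<and> u \<le> s \<and> A \<in> sets borel}"

definition transition_kernels :: "(real \<Rightarrow> 'a::topological_space \<Rightarrow> 'a measure) \<Rightarrow> bool" where
  "transition_kernels p \<longleftrightarrow> (\<forall>t\<ge>0. p t \<in> borel \<rightarrow>\<^sub>M prob_algebra borel)"

(* Time runs over the nonnegative reals; the values at negative times are unconstrained and unused.
   The last clause is P(X(s+t) in A | X(u), 0 <= u <= s) = p t (X s) A almost surely. *)
definition markov_process ::
    "'w measure \<Rightarrow> (real \<Rightarrow> 'w \<Rightarrow> 'a::topological_space) \<Rightarrow> (real \<Rightarrow> 'a \<Rightarrow> 'a measure) \<Rightarrow> bool" where
  "markov_process M X p \<longleftrightarrow>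
     prob_space M \<and> transition_kernels p \<and>
     (\<forall>t\<ge>0. X t \<in> borel_measurable M) \<and>
     (\<forall>s\<ge>0. \<forall>t\<ge>0. \<forall>A\<in>sets borel. AE \<omega> in M.
        real_cond_exp M (natural_filtration M X s) (\<lambda>\<omega>. indicator A (X (s + t) \<omega>)) \<omega>
          = measure (p t (X s \<omega>)) A)"

(* A time-homogeneous Markov process that can be started from every initial distribution nu:
   M nu and X nu are the probability space and the process for X(0) distributed as nu. *)
definition markov_family ::
    "('a::topological_space measure \<Rightarrow> 'w measure) \<Rightarrow> ('a measure \<Rightarrow> real \<Rightarrow> 'w \<Rightarrow> 'a)
      \<Rightarrow> (real \<Rightarrow> 'a \<Rightarrow> 'a measure) \<Rightarrow> bool" where
  "markov_family M X p \<longleftrightarrow>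
     (\<forall>\<nu>\<in>prob_measures. markov_process (M \<nu>) (X \<nu>) p \<and> distr (M \<nu>) borel (X \<nu> 0) = \<nu>)"

definition law_at ::
    "('a::topological_space measure \<Rightarrow> 'w measure) \<Rightarrow> ('a measure \<Rightarrow> real \<Rightarrow> 'w \<Rightarrow> 'a)
      \<Rightarrow> 'a measure \<Rightarrow> real \<Rightarrow> 'a measure" where
  "law_at M X \<nu> t = distr (M \<nu>) borel (X \<nu> t)"

lemma markov_process_law:
  fixes X :: "real \<Rightarrow> 'w \<Rightarrow> 'b::topological_space"
  assumes mp: "markov_process M X p" and s: "s \<ge> 0" and t: "t \<ge> 0"
  shows "distr M borel (X (s + t)) = distr M borel (X s) \<bind> p t"
proof -
  interpret prob_space M using mp by (simp add: markov_process_def)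
  let ?F = "natural_filtration M X s"
  have p [measurable]: "p t \<in> borel \<rightarrow>\<^sub>M prob_algebra borel"
    using mp t by (auto simp: markov_process_def transition_kernels_def)
  have X: "X u \<in> borel_measurable M" if "u \<ge> 0" for u
    using mp that by (auto simp: markov_process_def)
  have Xs [measurable]: "X s \<in> borel_measurable M"
    and Xst [measurable]: "X (s + t) \<in> borel_measurable M"
    using X s t by auto
  let ?G = "{X u -` A \<inter> space M |u A. 0 \<le> u \<and> u \<le> s \<and> A \<in> sets borel}"
  have "?G \<subseteq> sets M"
    using X by (auto simp: measurable_sets)
  moreover from this have "?G \<subseteq> Pow (space M)"
    using sets.space_closed by blast
  ultimately have sub: "subalgebra M ?F"
    unfolding subalgebra_def natural_filtration_def
    by (simp add: sets.sigma_sets_subset)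
  interpret finite_measure_subalgebra M ?F
    by unfold_locales (rule sub)
  have D: "distr M borel (X s) \<in> space (prob_algebra borel)"
    by (auto simp: space_prob_algebra intro!: prob_space_distr)
  have pS: "p t \<in> distr M borel (X s) \<rightarrow>\<^sub>M subprob_algebra borel"
    using measurable_prob_algebraD[OF p] by simp
  interpret Ds: prob_space "distr M borel (X s)"
    by (rule prob_space_distr) measurable
  have B: "distr M borel (X s) \<bind> p t \<in> space (prob_algebra borel)"
    using sets_bind'[OF D p] prob_space_bind'[OF D p] by (simp add: space_prob_algebra)
  interpret B: prob_space "distr M borel (X s) \<bind> p t"
    using B by (simp add: space_prob_algebra)
  interpret L: prob_space "distr M borel (X (s + t))"
    by (rule prob_space_distr) measurable
  show ?thesis
  proof (rule measure_eqI)
    show "sets (distr M borel (X (s + t))) = sets (distr M borel (X s) \<bind> p t)"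
      using B by (simp add: space_prob_algebra)
    fix A assume "A \<in> sets (distr M borel (X (s + t)))"
    then have A [measurable]: "A \<in> sets borel" by simp
    have int: "integrable M (\<lambda>\<omega>. indicator A (X (s + t) \<omega>) :: real)"
      by (rule integrable_const_bound[where B = 1]) (auto simp: indicator_def)
    have mk [measurable]: "(\<lambda>x. measure (p t x) A) \<in> borel_measurable borel"
      using measurable_compose[OF measurable_prob_algebraD[OF p] measurable_measure_subprob_algebra[OF A]]
      by (simp add: comp_def)
    have "measure (distr M borel (X (s + t))) A = (\<integral>\<omega>. indicator A (X (s + t) \<omega>) \<partial>M)"
      using integral_distr[OF Xst, of "indicator A :: 'b \<Rightarrow> real"] by simp
    also have "\<dots> = (\<integral>\<omega>. real_cond_exp M ?F (\<lambda>\<omega>. indicator A (X (s + t) \<omega>)) \<omega> \<partial>M)"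
      by (rule real_cond_exp_int(2)[OF int, symmetric])
    also have "\<dots> = (\<integral>\<omega>. measure (p t (X s \<omega>)) A \<partial>M)"
      using mp s t A by (intro integral_cong_AE) (auto simp: markov_process_def)
    also have "\<dots> = (\<integral>x. measure (p t x) A \<partial>distr M borel (X s))"
      by (rule integral_distr[symmetric]) measurable
    also have "\<dots> = measure (distr M borel (X s) \<bind> p t) A"
      by (rule Ds.measure_bind[OF pS A, symmetric])
    finally show "emeasure (distr M borel (X (s + t))) A = emeasure (distr M borel (X s) \<bind> p t) A"
      by (simp add: L.emeasure_eq_measure B.emeasure_eq_measure)
  qed
qed

lemma law_at_eq_bind:
  assumes "markov_family M X p" and "\<nu> \<in> prob_measures" and "t \<ge> 0"
  shows "law_at M X \<nu> t = \<nu> \<bind> p t"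
  using markov_process_law[of "M \<nu>" "X \<nu>" p 0 t] assms
  by (simp add: law_at_def markov_family_def)

lemma law_at_prob:
  assumes "markov_family M X p" and "\<nu> \<in> prob_measures" and "t \<ge> 0"
  shows "law_at M X \<nu> t \<in> prob_measures"
  using assms
  by (auto simp: law_at_def markov_family_def markov_process_def space_prob_algebra
      intro!: prob_space.prob_space_distr)

lemma law_at_semigroup:
  assumes "markov_family M X p" and "\<nu> \<in> prob_measures" and "s \<ge> 0" and "t \<ge> 0"
  shows "law_at M X (law_at M X \<nu> s) t = law_at M X \<nu> (s + t)"
  using markov_process_law[of "M \<nu>" "X \<nu>" p s t] law_at_eq_bind[OF assms(1) law_at_prob[OF assms(1-3)] assms(4)] assms
  by (simp add: law_at_def markov_family_def)

end

(* Choose T0 with C * exp (- \<beta> * T0) \<le> 1/2. The triangle inequality through the law obtained by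
   running X for time T0 from the law of X' at time t bounds f t, the distance of that law to \<pi>, by
   f (t + T0) \<le> \<epsilon> T0 + f t / 2. Iterating and summing the geometric series gives the bound with
   the rate ln 2 / T0; the factor 2 of M0 comes from rounding t down to a multiple of T0. *)
theory Submission
  imports Defs
begin

text \<open>The map taking \<open>x\<close> to \<open>e + x / 2\<close> has fixed point
  \<open>2 * e\<close>, so each step of length \<open>T\<close> halves the excess over
  \<open>2 * e\<close>; this is why the constant term does not grow with \<open>k\<close>.\<close>

lemma affine_halving_iterate:
  fixes f :: "real \<Rightarrow> real"
  assumes step: "\<And>t. t \<ge> 0 \<Longrightarrow> f (t + T) \<le> e + f t / 2"
    and "T \<ge> 0" "e \<ge> 0" "s \<ge> 0"
  shows "f (s + real k * T) \<le> 2 * e + f s / 2 ^ k"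
proof (induction k)
  case 0
  then show ?case using \<open>e \<ge> 0\<close> by simp
next
  case (Suc k)
  have "f (s + real k * T + T) \<le> e + f (s + real k * T) / 2"
    using assms by (intro step) simp
  also have "\<dots> \<le> e + (2 * e + f s / 2 ^ k) / 2"
    using Suc.IH by simp
  finally show ?case
    by (simp add: algebra_simps add_divide_distrib)
qed

text \<open>Iterates from the remainder \<open>s\<close> of \<open>t\<close> modulo
  \<open>T\<close>. Naming the point \<open>s\<close> instead of taking a supremum keeps the bound
  real even if \<open>f\<close> is unbounded on \<open>{0..T}\<close>.\<close>

lemma affine_halving_exp_decay:
  fixes f :: "real \<Rightarrow> real"
  assumes step: "\<And>t. t \<ge> 0 \<Longrightarrow> f (t + T) \<le> e + f t / 2"
    and nonneg: "\<And>t. t \<ge> 0 \<Longrightarrow> f t \<ge> 0"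
    and T: "T > 0" and e: "e \<ge> 0" and t: "t \<ge> 0"
  obtains s where "s \<in> {0..T}" and "f t \<le> 2 * e + 2 * f s * exp (- (ln 2 / T) * t)"
proof
  define k where "k = nat \<lfloor>t / T\<rfloor>"
  define s where "s = t - real k * T"
  have k: "real k = of_int \<lfloor>t / T\<rfloor>"
    using T t by (simp add: k_def)
  have "real k \<le> t / T" and "t / T < real k + 1"
    unfolding k by linarith+
  then have ks: "real k * T \<le> t" "t \<le> (real k + 1) * T"
    using T by (simp_all add: field_simps)
  then show s: "s \<in> {0..T}"
    by (simp add: s_def algebra_simps)
  \<comment> \<open>Since \<open>k\<close> exceeds \<open>t / T - 1\<close>, replacing it by
    \<open>t / T\<close> in the exponent costs at most a factor
    \<open>exp (ln 2) = 2\<close>.\<close>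
  have "1 / 2 ^ k = exp (- ln 2 * real k)"
    by (simp add: exp_minus exp_of_nat2_mult inverse_eq_divide)
  also have "\<dots> \<le> exp (ln 2 - (ln 2 / T) * t)"
  proof -
    have "ln 2 * (t / T) \<le> ln 2 * (real k + 1)"
      using \<open>t / T < real k + 1\<close> by (intro mult_left_mono) auto
    then show ?thesis by (simp add: algebra_simps)
  qed
  also have "\<dots> = 2 * exp (- (ln 2 / T) * t)"
    by (simp add: exp_diff exp_minus divide_inverse)
  finally have "f s * (1 / 2 ^ k) \<le> f s * (2 * exp (- (ln 2 / T) * t))"
    using nonneg s by (intro mult_left_mono) auto
  moreover have "f t \<le> 2 * e + f s / 2 ^ k"
    using affine_halving_iterate[of f T e s k] step T e s by (simp add: s_def)
  ultimately show "f t \<le> 2 * e + 2 * f s * exp (- (ln 2 / T) * t)"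
    by (simp add: mult.assoc mult.left_commute)
qed

lemma exp_decay_le_half:
  fixes C \<beta> :: real
  assumes "C > 0" and "\<beta> > 0"
  obtains T where "T > 0" and "C * exp (- \<beta> * T) \<le> 1 / 2"
proof
  \<comment> \<open>The second entry solves \<open>C * exp (- \<beta> * T) = 1 / 2\<close>, but it
    is not positive when \<open>C \<le> 1 / 2\<close>; the maximum with 1 repairs this.\<close>
  let ?T = "max 1 (ln (2 * C) / \<beta>)"
  show "?T > 0" by simp
  have "ln (2 * C) = \<beta> * (ln (2 * C) / \<beta>)"
    using assms by simp
  also have "\<dots> \<le> \<beta> * ?T"
    using assms by (intro mult_left_mono) auto
  finally have "exp (- \<beta> * ?T) \<le> exp (- ln (2 * C))" by simp
  also have "\<dots> = 1 / (2 * C)"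
    using assms by (simp add: exp_minus inverse_eq_divide)
  finally show "C * exp (- \<beta> * ?T) \<le> 1 / 2"
    using assms by (simp add: field_simps)
qed

theorem lemma2p1:
  fixes M :: "(real ^ 'd) measure \<Rightarrow> 'w measure"
    and X :: "(real ^ 'd) measure \<Rightarrow> real \<Rightarrow> 'w \<Rightarrow> real ^ 'd"
    and p :: "real \<Rightarrow> real ^ 'd \<Rightarrow> (real ^ 'd) measure"
    and M' :: "(real ^ 'd) measure \<Rightarrow> 'v measure"
    and X' :: "(real ^ 'd) measure \<Rightarrow> real \<Rightarrow> 'v \<Rightarrow> real ^ 'd"
    and p' :: "real \<Rightarrow> real ^ 'd \<Rightarrow> (real ^ 'd) measure"
    and \<rho> :: "(real ^ 'd) measure \<Rightarrow> (real ^ 'd) measure \<Rightarrow> real"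
    and \<pi> :: "(real ^ 'd) measure"
    and C \<beta> :: real and \<epsilon> :: "real \<Rightarrow> real"
  assumes "markov_family M X p" and "markov_family M' X' p'"
    and "Metric_space prob_measures \<rho>"
    and "\<pi> \<in> prob_measures"
    and "\<forall>t\<ge>0. law_at M X \<pi> t = \<pi>"
    and "C > 0" and "\<beta> > 0"
    and "\<forall>\<nu>\<in>prob_measures. \<forall>t\<ge>0.
           \<rho> (law_at M X \<nu> t) \<pi> \<le> C * exp (- \<beta> * t) * \<rho> \<nu> \<pi>"
    and "\<forall>T>0. \<forall>\<nu>\<in>prob_measures.
           (SUP t\<in>{0..T}. ereal (\<rho> (law_at M' X' \<nu> t) (law_at M X \<nu> t))) \<le> ereal (\<epsilon> T)"
  shows "\<exists>T0 \<kappa>. T0 > 0 \<and> \<kappa> > 0 \<and>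
           (\<forall>\<nu>\<in>prob_measures.
              let M0 = (SUP s\<in>{0..T0}. ereal (\<rho> (law_at M' X' \<nu> s) \<pi>)) in
              \<forall>t\<ge>0. ereal (\<rho> (law_at M' X' \<nu> t) \<pi>)
                \<le> ereal (2 * \<epsilon> T0) + 2 * M0 * ereal (exp (- \<kappa> * t)))"
proof -
  interpret Metric_space prob_measures \<rho> by fact
  have error: "\<rho> (law_at M' X' \<nu> t) (law_at M X \<nu> t) \<le> \<epsilon> T"
    if "T > 0" "\<nu> \<in> prob_measures" "0 \<le> t" "t \<le> T" for T \<nu> t
  proof -
    have "ereal (\<rho> (law_at M' X' \<nu> t) (law_at M X \<nu> t))
        \<le> (SUP t\<in>{0..T}. ereal (\<rho> (law_at M' X' \<nu> t) (law_at M X \<nu> t)))"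
      using that by (intro SUP_upper) simp
    also have "\<dots> \<le> ereal (\<epsilon> T)"
      using assms(9) that by blast
    finally show ?thesis by simp
  qed
  obtain T where T: "T > 0" and half: "C * exp (- \<beta> * T) \<le> 1 / 2"
    using exp_decay_le_half[OF assms(6,7)] .
  \<comment> \<open>The sign follows because \<open>\<epsilon> T\<close> dominates a distance;
    \<open>\<pi>\<close> serves as a sample initial law.\<close>
  have \<epsilon>: "\<epsilon> T \<ge> 0"
    using error[OF T assms(4), of 0] nonneg[of "law_at M' X' \<pi> 0" "law_at M X \<pi> 0"] T by linarith
  have main: "ereal (\<rho> (law_at M' X' \<nu> t) \<pi>) \<le> ereal (2 * \<epsilon> T)
      + 2 * (SUP s\<in>{0..T}. ereal (\<rho> (law_at M' X' \<nu> s) \<pi>)) * ereal (exp (- (ln 2 / T) * t))"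
    if \<nu>: "\<nu> \<in> prob_measures" and t: "t \<ge> 0" for \<nu> t
  proof -
    define f where "f r = \<rho> (law_at M' X' \<nu> r) \<pi>" for r
    have f_nonneg: "f r \<ge> 0" for r
      by (simp add: f_def)
    have step: "f (r + T) \<le> \<epsilon> T + f r / 2" if r: "r \<ge> 0" for r
    proof -
      \<comment> \<open>Both processes are restarted from this law. The error bound is uniform in
        the initial law, so the same \<open>\<epsilon> T\<close> applies at every
        \<open>r\<close>.\<close>
      let ?\<mu> = "law_at M' X' \<nu> r"
      have \<mu>: "?\<mu> \<in> prob_measures"
        using law_at_prob[OF assms(2) \<nu> r] .
      have "f (r + T) = \<rho> (law_at M' X' ?\<mu> T) \<pi>"
        using law_at_semigroup[OF assms(2) \<nu> r] T by (simp add: f_def)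
      also have "\<dots> \<le> \<rho> (law_at M' X' ?\<mu> T) (law_at M X ?\<mu> T) + \<rho> (law_at M X ?\<mu> T) \<pi>"
        using triangle law_at_prob[OF assms(2) \<mu>] law_at_prob[OF assms(1) \<mu>] assms(4) T by simp
      also have "\<dots> \<le> \<epsilon> T + C * exp (- \<beta> * T) * \<rho> ?\<mu> \<pi>"
        using error[OF T \<mu>, of T] assms(8) \<mu> T by (intro add_mono) auto
      also have "\<dots> \<le> \<epsilon> T + 1 / 2 * \<rho> ?\<mu> \<pi>"
        using half by (intro add_left_mono mult_right_mono) auto
      finally show ?thesis by (simp add: f_def)
    qed
    obtain s where s: "s \<in> {0..T}" and "f t \<le> 2 * \<epsilon> T + 2 * f s * exp (- (ln 2 / T) * t)"
      using affine_halving_exp_decay[of f T "\<epsilon> T" t, OF step f_nonneg T \<epsilon> t] .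
    then have "ereal (f t) \<le> ereal (2 * \<epsilon> T) + 2 * ereal (f s) * ereal (exp (- (ln 2 / T) * t))"
      by simp
    \<comment> \<open>Passing to the supremum in \<open>ereal\<close> avoids a separate proof that
      it is finite; monotonicity holds because the other factors are nonnegative.\<close>
    also have "\<dots> \<le> ereal (2 * \<epsilon> T)
        + 2 * (SUP s\<in>{0..T}. ereal (f s)) * ereal (exp (- (ln 2 / T) * t))"
      using s by (intro add_left_mono ereal_mult_right_mono ereal_mult_left_mono SUP_upper) auto
    finally show ?thesis by (simp add: f_def)
  qed
  \<comment> \<open>Both witnesses are determined by \<open>C\<close> and \<open>\<beta>\<close>
    alone, so they serve every \<open>\<nu>\<close>.\<close>
  show ?thesis
    unfolding Let_def using T main
    by (intro exI[of _ T] exI[of _ "ln 2 / T"] conjI ballI allI impI divide_pos_pos ln_gt_zero main) simp_all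
qed

end
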